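(* Assume that $G:\mathbb{H}\to\mathbb{R}$ is $\mu$-strongly convex and locally Lipschitz smooth (both with respect to the $\mathcal{L}$-norm). Let $r>1$, $x_0\in\mathbb{H}$, $\eta=\sqrt{\mu}$, and define $$\mathfrak{B}=\{x\in\mathbb{H} : \|x-x^*\|_{\mathcal{L}}\le R\},\quad R=R_1+\tfrac1\eta R_2,\quad R_1=\sqrt{\tfrac{2}{\mu}(G(x_0)-G^* )},\quad R_2=\sqrt{2r(G(x_0)-G^* )}.$$ Let $L_B>0$ be the local Lipschitz smoothness constant of $G$ associated with the set $\mathfrak{B}$, and let PAGD be run from $x_0$ with friction coefficient $\eta=\sqrt\mu$ and a step size $$s\in\left(0,\ \min\left\{L_B^{-1},\ \left(\tfrac{r-1}{r+1}\right)^2\mu^{-1}\right\}\right].$$ Then, for all $k\ge 0$, $\|x_k-x^*\|_{\mathcal{L}}\le R_1$ (hence $x_k\in\mathfrak{B}$), and $y_k,v_k\in\mathfrak{B}$.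
   Context: $\mathbb{H}$ is a real separable Hilbert space with norm $\|\cdot\|_{\mathbb{H}}$, $\mathbb{H}'$ is its dual, and $\langle f,v\rangle=f(v)$ is the duality pairing. The preconditioner $\mathcal{L}:\mathbb{H}\to\mathbb{H}'$ is a linear operator such that, with $(x,y)_{\mathcal{L}}:=\langle\mathcal{L}x,y\rangle$, there are $C_1,C_2>0$ with $(x,y)_{\mathcal{L}}=(y,x)_{\mathcal{L}}$, $(x,y)_{\mathcal{L}}\le C_2\|x\|_{\mathbb{H}}\|y\|_{\mathbb{H}}$, and $C_1\|x\|_{\mathbb{H}}^2\le (x,x)_{\mathcal{L}}$ for all $x,y\in\mathbb{H}$. Then $\|x\|_{\mathcal{L}}:=\sqrt{(x,x)_{\mathcal{L}}}$ is a norm equivalent to $\|\cdot\|_{\mathbb{H}}$ and $\mathcal{L}$ is invertible. $G:\mathbb{H}\to\mathbb{R}$ is Fréchet differentiable at every point, with derivative $G'(x)\in\mathbb{H}'$. $G$ is $\mu$-strongly convex if $\mu>0$ and $\langle G'(x)-G'(y),x-y\rangle\ge\mu\|x-y\|_{\mathcal{L}}^2$ for all $x,y\in\mathbb{H}$. $G$ is locally Lipschitz smooth if for every bounded convex set $B\subset\mathbb{H}$ there is $L_B>0$ such that $\langle G'(x)-G'(y),x-y\rangle\le L_B\|x-y\|_{\mathcal{L}}^2$ for all $x,y\in B$; such an $L_B$ is called a (local) Lipschitz smoothness constant associated with $B$. $x^*$ denotes the unique minimizer of $G$ over $\mathbb{H}$ and $G^*=G(x^* )$. PAGD (preconditioned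 accelerated gradient descent) with friction coefficient $\eta>0$, step size $s>0$ and initial guess $x_0\in\mathbb{H}$: set $\theta=\eta\sqrt{s}$, $\lambda=\frac{1-\theta}{1+\theta}$, $x_{-1}=v_0=x_0$, and for $k\ge0$ $$y_k=x_k+\lambda(x_k-x_{k-1}),\qquad x_{k+1}=y_k-s\,\mathcal{L}^{-1}G'(y_k),\qquad v_{k+1}=x_k+\tfrac1\theta(x_{k+1}-x_k).$$ *)

theory Defs
  imports "HOL-Analysis.Analysis"
begin

definition L_inner :: "('h::real_normed_vector \<Rightarrow> ('h \<Rightarrow>\<^sub>L real)) \<Rightarrow> 'h \<Rightarrow> 'h \<Rightarrow> real" where
  "L_inner \<L> x y = blinfun_apply (\<L> x) y"

definition L_norm :: "('h::real_normed_vector \<Rightarrow> ('h \<Rightarrow>\<^sub>L real)) \<Rightarrow> 'h \<Rightarrow> real" where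
  "L_norm \<L> x = sqrt (L_inner \<L> x x)"

definition preconditioner :: "('h::real_normed_vector \<Rightarrow> ('h \<Rightarrow>\<^sub>L real)) \<Rightarrow> bool" where
  "preconditioner \<L> \<longleftrightarrow> linear \<L> \<and>
     (\<exists>C1>0. \<exists>C2>0. \<forall>x y.
        L_inner \<L> x y = L_inner \<L> y x \<and>
        L_inner \<L> x y \<le> C2 * norm x * norm y \<and>
        C1 * (norm x)\<^sup>2 \<le> L_inner \<L> x x)"

text \<open>In the following, \<open>G'\<close> stands for the Frechet derivative of the objective, as a map
  into the dual space.\<close>

definition frechet_deriv :: "('h::real_normed_vector \<Rightarrow> real) \<Rightarrow> ('h \<Rightarrow> ('h \<Rightarrow>\<^sub>L real)) \<Rightarrow> bool" where
  "frechet_deriv G G' \<longleftrightarrow> (\<forall>x. (G has_derivative blinfun_apply (G' x)) (at x))"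

definition strongly_convex ::
  "('h::real_normed_vector \<Rightarrow> ('h \<Rightarrow>\<^sub>L real)) \<Rightarrow> ('h \<Rightarrow> ('h \<Rightarrow>\<^sub>L real)) \<Rightarrow> real \<Rightarrow> bool" where
  "strongly_convex \<L> G' \<mu> \<longleftrightarrow> \<mu> > 0 \<and>
     (\<forall>x y. blinfun_apply (G' x - G' y) (x - y) \<ge> \<mu> * (L_norm \<L> (x - y))\<^sup>2)"

definition smoothness_constant ::
  "('h::real_normed_vector \<Rightarrow> ('h \<Rightarrow>\<^sub>L real)) \<Rightarrow> ('h \<Rightarrow> ('h \<Rightarrow>\<^sub>L real)) \<Rightarrow> 'h set \<Rightarrow> real \<Rightarrow> bool" where
  "smoothness_constant \<L> G' B L_B \<longleftrightarrow> L_B > 0 \<and>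
     (\<forall>x\<in>B. \<forall>y\<in>B. blinfun_apply (G' x - G' y) (x - y) \<le> L_B * (L_norm \<L> (x - y))\<^sup>2)"

definition locally_Lipschitz_smooth ::
  "('h::real_normed_vector \<Rightarrow> ('h \<Rightarrow>\<^sub>L real)) \<Rightarrow> ('h \<Rightarrow> ('h \<Rightarrow>\<^sub>L real)) \<Rightarrow> bool" where
  "locally_Lipschitz_smooth \<L> G' \<longleftrightarrow>
     (\<forall>B. bounded B \<and> convex B \<longrightarrow> (\<exists>L_B. smoothness_constant \<L> G' B L_B))"

text \<open>Meaningful only if a unique global minimizer exists, which holds for strongly convex
  objectives on a Hilbert space.\<close>

definition minimizer :: "('h \<Rightarrow> real) \<Rightarrow> 'h" where
  "minimizer G = (THE x. \<forall>y. G x \<le> G y)"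

definition pagd_theta :: "real \<Rightarrow> real \<Rightarrow> real" where
  "pagd_theta \<eta> s = \<eta> * sqrt s"

definition pagd_lambda :: "real \<Rightarrow> real \<Rightarrow> real" where
  "pagd_lambda \<eta> s = (1 - pagd_theta \<eta> s) / (1 + pagd_theta \<eta> s)"

definition pagd_extrapolate :: "real \<Rightarrow> real \<Rightarrow> 'h \<times> 'h \<Rightarrow> 'h::real_vector" where
  "pagd_extrapolate \<eta> s = (\<lambda>(x_prev, x). x + pagd_lambda \<eta> s *\<^sub>R (x - x_prev))"

text \<open>The \<open>k\<close>-th state is the pair \<open>(x\<^sub>k\<^sub>-\<^sub>1, x\<^sub>k)\<close>, which accommodates the starting index -1.
  The total function \<open>inv \<L>\<close> is the genuine inverse of \<open>\<L>\<close>, since a preconditioner on a Hilbert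
  space is bijective onto the dual.\<close>

primrec pagd_state ::
  "('h::real_normed_vector \<Rightarrow> ('h \<Rightarrow>\<^sub>L real)) \<Rightarrow> ('h \<Rightarrow> ('h \<Rightarrow>\<^sub>L real)) \<Rightarrow>
   real \<Rightarrow> real \<Rightarrow> 'h \<Rightarrow> nat \<Rightarrow> 'h \<times> 'h" where
  "pagd_state \<L> G' \<eta> s x0 0 = (x0, x0)"
| "pagd_state \<L> G' \<eta> s x0 (Suc k) =
     (let y = pagd_extrapolate \<eta> s (pagd_state \<L> G' \<eta> s x0 k)
      in (snd (pagd_state \<L> G' \<eta> s x0 k), y - s *\<^sub>R inv \<L> (G' y)))"

definition pagd_x ::
  "('h::real_normed_vector \<Rightarrow> ('h \<Rightarrow>\<^sub>L real)) \<Rightarrow> ('h \<Rightarrow> ('h \<Rightarrow>\<^sub>L real)) \<Rightarrow>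
   real \<Rightarrow> real \<Rightarrow> 'h \<Rightarrow> nat \<Rightarrow> 'h" where
  "pagd_x \<L> G' \<eta> s x0 k = snd (pagd_state \<L> G' \<eta> s x0 k)"

definition pagd_y ::
  "('h::real_normed_vector \<Rightarrow> ('h \<Rightarrow>\<^sub>L real)) \<Rightarrow> ('h \<Rightarrow> ('h \<Rightarrow>\<^sub>L real)) \<Rightarrow>
   real \<Rightarrow> real \<Rightarrow> 'h \<Rightarrow> nat \<Rightarrow> 'h" where
  "pagd_y \<L> G' \<eta> s x0 k = pagd_extrapolate \<eta> s (pagd_state \<L> G' \<eta> s x0 k)"

primrec pagd_v ::
  "('h::real_normed_vector \<Rightarrow> ('h \<Rightarrow>\<^sub>L real)) \<Rightarrow> ('h \<Rightarrow> ('h \<Rightarrow>\<^sub>L real)) \<Rightarrow>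
   real \<Rightarrow> real \<Rightarrow> 'h \<Rightarrow> nat \<Rightarrow> 'h" where
  "pagd_v \<L> G' \<eta> s x0 0 = x0"
| "pagd_v \<L> G' \<eta> s x0 (Suc k) = pagd_x \<L> G' \<eta> s x0 k +
     (1 / pagd_theta \<eta> s) *\<^sub>R (pagd_x \<L> G' \<eta> s x0 (Suc k) - pagd_x \<L> G' \<eta> s x0 k)"

end

theory Submission
  imports Defs
begin

text \<open>Write \<open>d\<^sub>k = x\<^sub>k - x\<^sub>k\<^sub>-\<^sub>1\<close>. The proof rests on the mechanical energy
  \<open>E\<^sub>k = G x\<^sub>k + \<parallel>d\<^sub>k\<parallel>\<^sup>2 / (2 s)\<close>, with \<open>\<parallel>\<cdot>\<parallel>\<close> the norm of the preconditioner. Along the iteration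
  it never exceeds its initial value \<open>G x\<^sub>0\<close>: adding the descent estimate for the gradient step
  from \<open>y\<^sub>k\<close>, the convexity inequality between \<open>y\<^sub>k\<close> and \<open>x\<^sub>k\<close>, and the expansion of
  \<open>\<parallel>d\<^sub>k\<^sub>+\<^sub>1\<parallel>\<^sup>2\<close>, where \<open>d\<^sub>k\<^sub>+\<^sub>1 = \<beta> d\<^sub>k - s \<L>\<^sup>-\<^sup>1 G' y\<^sub>k\<close> with the
  extrapolation weight \<open>\<beta> = pagd_lambda \<eta> s\<close> in \<open>[0, 1]\<close>, all terms with the gradient cancel
  (\<open>accelerated_step_energy\<close>).

  The energy bound controls all three sequences. The bound on \<open>G x\<^sub>k\<close> and strong convexity give
  \<open>\<parallel>x\<^sub>k - x\<^sup>*\<parallel> \<le> R1\<close>; the bound on the kinetic part gives \<open>\<parallel>d\<^sub>k\<parallel> / \<theta> \<le> R2 / \<eta>\<close>. Since \<open>y\<^sub>k\<close> and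
  \<open>v\<^sub>k\<close> are displaced from an \<open>x\<close>-iterate by at most \<open>\<parallel>d\<parallel> / \<theta>\<close>, they lie in the ball of radius
  \<open>R = R1 + R2 / \<eta>\<close>.

  Smoothness is known only inside that ball, so the descent estimate requires
  \<open>x\<^sub>k\<^sub>+\<^sub>1\<close> to be in the ball before its energy is known. This holds because a
  gradient step of length at most \<open>1 / L_B\<close> does not increase the distance to the minimizer
  (\<open>gradient_step_nonexpansive\<close>).

  Completeness of the space enters twice: it provides the minimizer \<open>x\<^sup>*\<close>
  (\<open>strongly_convex_minimizer_exists\<close>) and the surjectivity of \<open>\<L>\<close> (\<open>preconditioner_surj\<close>).\<close>

section \<open>The inner product induced by the preconditioner\<close>

lemma preconditioner_linear: "preconditioner \<L> \<Longrightarrow> linear \<L>"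
  by (simp add: preconditioner_def)

lemma L_inner_commute: "preconditioner \<L> \<Longrightarrow> L_inner \<L> x y = L_inner \<L> y x"
  unfolding preconditioner_def by blast

lemma preconditioner_coercive:
  assumes "preconditioner \<L>"
  obtains C where "C > 0" "\<And>x. C * (norm x)\<^sup>2 \<le> L_inner \<L> x x"
  using assms unfolding preconditioner_def by blast

lemma preconditioner_bounded_linear:
  fixes \<L> :: "'h::real_normed_vector \<Rightarrow> ('h \<Rightarrow>\<^sub>L real)"
  assumes "preconditioner \<L>"
  shows "bounded_linear \<L>"
proof -
  interpret linear \<L> by (rule preconditioner_linear[OF assms])
  obtain C where C: "C > 0" "\<And>x y. L_inner \<L> x y \<le> C * norm x * norm y"
    using assms unfolding preconditioner_def by blast
  have "norm (\<L> x) \<le> norm x * C" for x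
  proof (rule norm_blinfun_bound)
    show "0 \<le> norm x * C" using C(1) by simp
    fix y
    have "- blinfun_apply (\<L> x) y \<le> C * norm x * norm y"
      using C(2)[of x "- y"] by (simp add: L_inner_def blinfun.minus_right)
    then show "norm (blinfun_apply (\<L> x) y) \<le> norm x * C * norm y"
      using C(2)[of x y] by (simp add: L_inner_def abs_le_iff mult_ac)
  qed
  then show ?thesis
    by (intro bounded_linear.intro bounded_linear_axioms.intro linear_axioms) blast
qed

lemma L_inner_bilinear:
  assumes "preconditioner \<L>"
  shows "L_inner \<L> (x + y) z = L_inner \<L> x z + L_inner \<L> y z"
    and "L_inner \<L> (x - y) z = L_inner \<L> x z - L_inner \<L> y z"
    and "L_inner \<L> (c *\<^sub>R x) z = c * L_inner \<L> x z"
    and "L_inner \<L> x (y + z) = L_inner \<L> x y + L_inner \<L> x z"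
    and "L_inner \<L> x (y - z) = L_inner \<L> x y - L_inner \<L> x z"
    and "L_inner \<L> x (c *\<^sub>R y) = c * L_inner \<L> x y"
  using preconditioner_linear[OF assms]
  by (simp_all add: L_inner_def linear_add linear_diff linear_scale blinfun.bilinear_simps)

lemma L_inner_nonneg: "preconditioner \<L> \<Longrightarrow> 0 \<le> L_inner \<L> x x"
  by (metis preconditioner_coercive zero_le_power2 less_imp_le mult_nonneg_nonneg order_trans)

lemma L_norm_power2: "preconditioner \<L> \<Longrightarrow> (L_norm \<L> x)\<^sup>2 = L_inner \<L> x x"
  by (simp add: L_norm_def L_inner_nonneg)

lemma L_norm_nonneg: "preconditioner \<L> \<Longrightarrow> 0 \<le> L_norm \<L> x"
  by (simp add: L_norm_def L_inner_nonneg)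

lemma L_norm_eq_0:
  assumes "preconditioner \<L>" "L_norm \<L> x = 0"
  shows "x = 0"
proof -
  obtain C where C: "C > 0" "\<And>x. C * (norm x)\<^sup>2 \<le> L_inner \<L> x x"
    using preconditioner_coercive[OF assms(1)] by blast
  have "C * (norm x)\<^sup>2 \<le> 0" using C(2)[of x] assms by (simp add: L_norm_def)
  then show ?thesis using C(1) by (simp add: mult_le_0_iff)
qed

lemma L_norm_scaleR: "preconditioner \<L> \<Longrightarrow> L_norm \<L> (c *\<^sub>R x) = \<bar>c\<bar> * L_norm \<L> x"
  by (simp add: L_norm_def L_inner_bilinear real_sqrt_mult flip: mult.assoc)

lemma L_inner_Cauchy_Schwarz:
  assumes P: "preconditioner \<L>"
  shows "L_inner \<L> x y \<le> L_norm \<L> x * L_norm \<L> y"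
proof (cases "L_norm \<L> x = 0 \<or> L_norm \<L> y = 0")
  case True
  then have "x = 0 \<or> y = 0" using L_norm_eq_0[OF P] by blast
  then have "L_inner \<L> x y = 0"
    using L_inner_bilinear(3)[OF P, of 0 0 y] L_inner_bilinear(6)[OF P, of x 0 0] by auto
  then show ?thesis using True by auto
next
  case False
  define a where "a = L_norm \<L> x"
  define b where "b = L_norm \<L> y"
  have ab: "a > 0" "b > 0"
    using False L_norm_nonneg[OF P, of x] L_norm_nonneg[OF P, of y] by (auto simp: a_def b_def)
  have "0 \<le> L_inner \<L> (b *\<^sub>R x - a *\<^sub>R y) (b *\<^sub>R x - a *\<^sub>R y)"
    by (rule L_inner_nonneg[OF P])
  also have "\<dots> = b * b * L_inner \<L> x x - 2 * (a * b) * L_inner \<L> x y + a * a * L_inner \<L> y y"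
    using L_inner_commute[OF P, of y x] by (simp add: L_inner_bilinear[OF P] algebra_simps)
  also have "\<dots> = 2 * (a * b) * (a * b - L_inner \<L> x y)"
    using L_norm_power2[OF P, of x] L_norm_power2[OF P, of y]
    by (simp add: a_def[symmetric] b_def[symmetric] power2_eq_square algebra_simps flip: L_norm_power2)
  finally have "0 \<le> a * b - L_inner \<L> x y"
    using mult_pos_pos[OF ab] by (simp only: zero_le_mult_iff) linarith
  then show ?thesis by (simp add: a_def b_def)
qed

lemma L_norm_triangle:
  assumes P: "preconditioner \<L>"
  shows "L_norm \<L> (x + y) \<le> L_norm \<L> x + L_norm \<L> y"
proof (rule power2_le_imp_le)
  have "(L_norm \<L> (x + y))\<^sup>2 = (L_norm \<L> x)\<^sup>2 + 2 * L_inner \<L> x y + (L_norm \<L> y)\<^sup>2"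
    using L_inner_commute[OF P, of y x] by (simp add: L_norm_power2[OF P] L_inner_bilinear[OF P])
  then show "(L_norm \<L> (x + y))\<^sup>2 \<le> (L_norm \<L> x + L_norm \<L> y)\<^sup>2"
    using L_inner_Cauchy_Schwarz[OF P, of x y] by (simp add: power2_sum)
  show "0 \<le> L_norm \<L> x + L_norm \<L> y" by (simp add: L_norm_nonneg[OF P])
qed

section \<open>Quadratic bounds along segments\<close>

text \<open>The hypothesis says that \<open>G (x + t d) - t G' x d - c t\<^sup>2 / 2\<close> is nondecreasing in \<open>t\<close>. Applied to
  \<open>G\<close> it turns monotonicity of the derivative into strong convexity bounds, and applied to
  \<open>-G\<close>, with negative \<open>c\<close>, it yields the upper bound from smoothness.\<close>

lemma segment_lower_quadratic:
  assumes F: "frechet_deriv G G'"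
    and mono: "\<And>t. 0 < t \<Longrightarrow> t \<le> 1 \<Longrightarrow>
      c * t \<le> blinfun_apply (G' (x + t *\<^sub>R d)) d - blinfun_apply (G' x) d"
  shows "G x + blinfun_apply (G' x) d + c / 2 \<le> G (x + d)"
proof -
  define \<phi> where "\<phi> t = G (x + t *\<^sub>R d) - t * blinfun_apply (G' x) d - c * t\<^sup>2 / 2" for t
  have "\<phi> 0 \<le> \<phi> 1"
  proof (rule DERIV_nonneg_imp_nondecreasing[of 0 1])
    fix t :: real assume t: "0 \<le> t" "t \<le> 1"
    have "(G has_derivative blinfun_apply (G' (x + t *\<^sub>R d))) (at (x + t *\<^sub>R d))"
      using F by (simp add: frechet_deriv_def)
    moreover have "((\<lambda>t. x + t *\<^sub>R d) has_derivative (\<lambda>u. u *\<^sub>R d)) (at t)"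
      by (auto intro!: derivative_eq_intros)
    ultimately have "((\<lambda>t. G (x + t *\<^sub>R d)) has_derivative
        (\<lambda>u. blinfun_apply (G' (x + t *\<^sub>R d)) (u *\<^sub>R d))) (at t)"
      by (rule has_derivative_compose[where f = "\<lambda>t. x + t *\<^sub>R d", rotated])
    then have "((\<lambda>t. G (x + t *\<^sub>R d)) has_real_derivative blinfun_apply (G' (x + t *\<^sub>R d)) d) (at t)"
      by (simp add: has_field_derivative_def blinfun.scaleR_right mult.commute[of _ "blinfun_apply _ _"])
    then have "(\<phi> has_real_derivative
        blinfun_apply (G' (x + t *\<^sub>R d)) d - blinfun_apply (G' x) d - c * t) (at t)"
      unfolding \<phi>_def by (auto intro!: derivative_eq_intros)
    moreover have "0 \<le> blinfun_apply (G' (x + t *\<^sub>R d)) d - blinfun_apply (G' x) d - c * t"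
      using mono[of t] t by (cases "t = 0") auto
    ultimately show "\<exists>y. (\<phi> has_real_derivative y) (at t) \<and> 0 \<le> y" by blast
  qed simp
  then show ?thesis by (simp add: \<phi>_def)
qed

lemma strongly_convex_quadratic_bound:
  assumes P: "preconditioner \<L>" and F: "frechet_deriv G G'" and S: "strongly_convex \<L> G' \<mu>"
  shows "G x + blinfun_apply (G' x) (y - x) + \<mu> / 2 * (L_norm \<L> (y - x))\<^sup>2 \<le> G y"
proof -
  define d where "d = y - x"
  have "G x + blinfun_apply (G' x) d + (\<mu> * (L_norm \<L> d)\<^sup>2) / 2 \<le> G (x + d)"
  proof (rule segment_lower_quadratic[OF F])
    fix t :: real assume t: "0 < t"
    have "\<mu> * (L_norm \<L> (t *\<^sub>R d))\<^sup>2 \<le> blinfun_apply (G' (x + t *\<^sub>R d) - G' x) (t *\<^sub>R d)"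
      using S unfolding strongly_convex_def by (metis add_diff_cancel_left')
    then have "t * (\<mu> * (L_norm \<L> d)\<^sup>2 * t) \<le>
        t * (blinfun_apply (G' (x + t *\<^sub>R d)) d - blinfun_apply (G' x) d)"
      using t by (simp add: L_norm_scaleR[OF P] blinfun.bilinear_simps power2_eq_square mult_ac)
    then show "\<mu> * (L_norm \<L> d)\<^sup>2 * t \<le> blinfun_apply (G' (x + t *\<^sub>R d)) d - blinfun_apply (G' x) d"
      using t by simp
  qed
  then show ?thesis by (simp add: d_def)
qed

lemma smoothness_quadratic_bound:
  assumes P: "preconditioner \<L>" and F: "frechet_deriv G G'"
    and S: "smoothness_constant \<L> G' B L" and B: "convex B" "x \<in> B" "y \<in> B"
  shows "G y \<le> G x + blinfun_apply (G' x) (y - x) + L / 2 * (L_norm \<L> (y - x))\<^sup>2"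
proof -
  define d where "d = y - x"
  have "- G x + blinfun_apply (- G' x) d + (- (L * (L_norm \<L> d)\<^sup>2)) / 2 \<le> - G (x + d)"
  proof (rule segment_lower_quadratic)
    show "frechet_deriv (\<lambda>x. - G x) (\<lambda>x. - G' x)"
      using F by (auto simp: frechet_deriv_def blinfun.minus_left intro!: derivative_eq_intros)
    fix t :: real assume t: "0 < t" "t \<le> 1"
    have "x + t *\<^sub>R d = (1 - t) *\<^sub>R x + t *\<^sub>R y" by (simp add: d_def algebra_simps)
    then have "x + t *\<^sub>R d \<in> B" using B t by (simp add: convex_alt)
    then have "blinfun_apply (G' (x + t *\<^sub>R d) - G' x) (t *\<^sub>R d) \<le> L * (L_norm \<L> (t *\<^sub>R d))\<^sup>2"
      using S B(2) unfolding smoothness_constant_def by (metis add_diff_cancel_left')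
    then have "t * (blinfun_apply (G' (x + t *\<^sub>R d)) d - blinfun_apply (G' x) d) \<le>
        t * (L * (L_norm \<L> d)\<^sup>2 * t)"
      using t by (simp add: L_norm_scaleR[OF P] blinfun.bilinear_simps power2_eq_square mult_ac)
    then show "- (L * (L_norm \<L> d)\<^sup>2) * t \<le>
        blinfun_apply (- G' (x + t *\<^sub>R d)) d - blinfun_apply (- G' x) d"
      using t by (simp add: blinfun.minus_left)
  qed
  then show ?thesis by (simp add: d_def blinfun.minus_left)
qed

section \<open>Minimizers of strongly convex functions\<close>

lemma strongly_convex_midpoint:
  assumes P: "preconditioner \<L>" and F: "frechet_deriv G G'" and S: "strongly_convex \<L> G' \<mu>"
  shows "G ((1/2) *\<^sub>R (x + y)) + \<mu> / 8 * (L_norm \<L> (x - y))\<^sup>2 \<le> (G x + G y) / 2"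
proof -
  define m where "m = (1/2) *\<^sub>R (x + y)"
  have d: "x - m = (1/2) *\<^sub>R (x - y)" "y - m = (-1/2) *\<^sub>R (x - y)"
    unfolding m_def by (simp_all add: algebra_simps flip: scaleR_add_left)
  show ?thesis
    using strongly_convex_quadratic_bound[OF P F S, of m x]
      strongly_convex_quadratic_bound[OF P F S, of m y]
    unfolding d L_norm_scaleR[OF P] m_def[symmetric] blinfun.scaleR_right
    by (simp add: power_mult_distrib power_divide)
qed

lemma strongly_convex_bdd_below:
  assumes P: "preconditioner \<L>" and F: "frechet_deriv G G'" and S: "strongly_convex \<L> G' \<mu>"
  shows "bdd_below (range G)"
proof -
  obtain C where C: "C > 0" "\<And>x. C * (norm x)\<^sup>2 \<le> L_inner \<L> x x"
    using preconditioner_coercive[OF P] by blast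
  have mu: "\<mu> > 0" using S by (simp add: strongly_convex_def)
  define a where "a = \<mu> / 2 * C"
  define K where "K = norm (G' 0)"
  have a: "a > 0" using mu C by (simp add: a_def)
  have "G 0 - K\<^sup>2 / (4 * a) \<le> G x" for x
  proof -
    have "- (K * norm x) \<le> blinfun_apply (G' 0) x"
      using norm_blinfun[of "G' 0" x] by (simp add: K_def)
    moreover have "a * (norm x)\<^sup>2 \<le> \<mu> / 2 * (L_norm \<L> x)\<^sup>2"
      using C(2)[of x] mu by (simp add: a_def L_norm_power2[OF P])
    \<comment> \<open>Completing the square in \<open>norm x\<close>.\<close>
    moreover have "0 \<le> (2 * a * norm x - K)\<^sup>2 / (4 * a)" using a by simp
    then have "- (K\<^sup>2 / (4 * a)) \<le> a * (norm x)\<^sup>2 - K * norm x"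
      using a by (simp add: power2_eq_square field_simps)
    ultimately show ?thesis
      using strongly_convex_quadratic_bound[OF P F S, of 0 x] by simp
  qed
  then show ?thesis by (auto simp: bdd_below_def)
qed

text \<open>The midpoint inequality makes every minimizing sequence a Cauchy sequence.\<close>

lemma strongly_convex_minimizer_exists:
  fixes \<L> :: "'h::{real_normed_vector,complete_space} \<Rightarrow> ('h \<Rightarrow>\<^sub>L real)"
  assumes P: "preconditioner \<L>" and F: "frechet_deriv G G'" and S: "strongly_convex \<L> G' \<mu>"
  shows "\<exists>x. \<forall>y. G x \<le> G y"
proof -
  define m where "m = Inf (range G)"
  have m: "m \<le> G x" for x
    unfolding m_def by (rule cInf_lower[OF _ strongly_convex_bdd_below[OF P F S]]) simp
  have "\<exists>x. G x < m + inverse (real (Suc n))" for n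
    using cInf_lessD[of "range G" "m + inverse (real (Suc n))"] by (auto simp: m_def)
  then obtain x where x: "\<And>n. G (x n) < m + inverse (real (Suc n))" by metis
  obtain C where C: "C > 0" "\<And>x. C * (norm x)\<^sup>2 \<le> L_inner \<L> x x"
    using preconditioner_coercive[OF P] by blast
  have mu: "\<mu> > 0" using S by (simp add: strongly_convex_def)
  define a where "a = \<mu> / 8 * C"
  have a: "a > 0" using mu C by (simp add: a_def)
  have average: "(p + q) / 2 - m \<le> (u + v) / 2" if "p < m + u" "q < m + v" for p q u v
    using that by (simp add: field_simps)
  have dist: "a * (norm (x i - x j))\<^sup>2 \<le> inverse (real (Suc n))" if "n \<le> i" "n \<le> j" for i j n
  proof -
    have "a * (norm (x i - x j))\<^sup>2 \<le> \<mu> / 8 * (L_norm \<L> (x i - x j))\<^sup>2"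
      using C(2)[of "x i - x j"] mu by (simp add: a_def L_norm_power2[OF P])
    also have "\<dots> \<le> (G (x i) + G (x j)) / 2 - m"
      using strongly_convex_midpoint[OF P F S, of "x i" "x j"] m[of "(1/2) *\<^sub>R (x i + x j)"] by linarith
    also have "\<dots> \<le> (inverse (real (Suc i)) + inverse (real (Suc j))) / 2"
      by (rule average[OF x x])
    also have "\<dots> \<le> inverse (real (Suc n))"
    proof -
      have "inverse (real (Suc l)) \<le> inverse (real (Suc n))" if "n \<le> l" for l
        using that by (intro le_imp_inverse_le) auto
      from add_mono[OF this[OF that(1)] this[OF that(2)]] show ?thesis by simp
    qed
    finally show ?thesis .
  qed
  have "Cauchy x"
  proof (rule metric_CauchyI)
    fix e :: real assume e: "e > 0"
    then obtain n where n: "inverse (real (Suc n)) < a * e\<^sup>2"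
      using reals_Archimedean[of "a * e\<^sup>2"] a by auto
    have "dist (x i) (x j) < e" if "i \<ge> n" "j \<ge> n" for i j
    proof -
      have "a * (norm (x i - x j))\<^sup>2 < a * e\<^sup>2" using dist[OF that] n by linarith
      then have "(norm (x i - x j))\<^sup>2 < e\<^sup>2" using a by simp
      then show ?thesis using e by (simp add: dist_norm power2_less_imp_less)
    qed
    then show "\<exists>n. \<forall>i\<ge>n. \<forall>j\<ge>n. dist (x i) (x j) < e" by blast
  qed
  then obtain z where z: "x \<longlonglongrightarrow> z" using Cauchy_convergent convergent_def by blast
  have "isCont G z" using F unfolding frechet_deriv_def by (blast intro: has_derivative_continuous)
  then have "(\<lambda>n. G (x n)) \<longlonglongrightarrow> G z" using z by (rule isCont_tendsto_compose)
  moreover have "(\<lambda>n. m + inverse (real (Suc n))) \<longlonglongrightarrow> m"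
    using LIMSEQ_inverse_real_of_nat_add by simp
  ultimately have "G z \<le> m"
    using x by (intro LIMSEQ_le) (auto intro: less_imp_le)
  then show ?thesis using m order_trans by blast
qed

lemma frechet_deriv_global_min:
  assumes "frechet_deriv G G'" "\<And>y. G x \<le> G y"
  shows "G' x = 0"
proof (rule blinfun_eqI)
  fix v
  have "blinfun_apply (G' x) = (\<lambda>v. 0)"
    using assms differential_zero_maxmin[of x UNIV G "blinfun_apply (G' x)"]
    by (auto simp: frechet_deriv_def)
  then show "blinfun_apply (G' x) v = blinfun_apply 0 v" by simp
qed

lemma minimizer_le:
  fixes \<L> :: "'h::{real_normed_vector,complete_space} \<Rightarrow> ('h \<Rightarrow>\<^sub>L real)"
  assumes P: "preconditioner \<L>" and F: "frechet_deriv G G'" and S: "strongly_convex \<L> G' \<mu>"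
  shows "G (minimizer G) \<le> G y"
proof -
  have mu: "\<mu> > 0" using S by (simp add: strongly_convex_def)
  obtain x where x: "\<forall>y. G x \<le> G y" using strongly_convex_minimizer_exists[OF P F S] by blast
  have "z = x" if z: "\<forall>y. G z \<le> G y" for z
  proof -
    have "\<mu> / 2 * (L_norm \<L> (z - x))\<^sup>2 \<le> 0"
      using strongly_convex_quadratic_bound[OF P F S, of x z] z x
        frechet_deriv_global_min[OF F, of x] by (auto dest: spec[of _ x])
    then have "L_norm \<L> (z - x) = 0" using mu by (simp add: mult_le_0_iff)
    then show ?thesis using L_norm_eq_0[OF P] by fastforce
  qed
  then have "minimizer G = x" unfolding minimizer_def using x by (intro the_equality) blast+
  then show ?thesis using x by simp
qed

text \<open>Surjectivity of the preconditioner (the symmetric Lax--Milgram theorem): \<open>\<L> x = f\<close> is the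
  stationarity condition of the energy \<open>x \<mapsto> (x, x)\<^sub>\<L> / 2 - f x\<close>, which is strongly convex with
  constant 1 in the norm of \<open>\<L>\<close> and hence has a minimizer.\<close>

lemma preconditioner_surj:
  fixes \<L> :: "'h::{real_normed_vector,complete_space} \<Rightarrow> ('h \<Rightarrow>\<^sub>L real)"
  assumes P: "preconditioner \<L>"
  shows "surj \<L>"
unfolding surj_def
proof
  fix f :: "'h \<Rightarrow>\<^sub>L real"
  define J where "J x = blinfun_apply (\<L> x) x / 2 - blinfun_apply f x" for x
  have F: "frechet_deriv J (\<lambda>x. \<L> x - f)"
    unfolding frechet_deriv_def
  proof
    fix x
    have "(\<L> has_derivative \<L>) (at x)"
      by (rule bounded_linear_imp_has_derivative[OF preconditioner_bounded_linear[OF P]])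
    then have "((\<lambda>x. blinfun_apply (\<L> x) x) has_derivative
        (\<lambda>h. blinfun_apply (\<L> x) h + blinfun_apply (\<L> h) x)) (at x)"
      by (rule bounded_bilinear.FDERIV[OF bounded_bilinear_blinfun_apply]) simp
    moreover have "blinfun_apply (\<L> h) x = blinfun_apply (\<L> x) h" for h
      using L_inner_commute[OF P, of h x] by (simp add: L_inner_def)
    ultimately have "((\<lambda>x. blinfun_apply (\<L> x) x) has_derivative
        (\<lambda>h. 2 * blinfun_apply (\<L> x) h)) (at x)" by simp
    then have "((\<lambda>x. 1 / 2 * blinfun_apply (\<L> x) x) has_derivative
        (\<lambda>h. 1 / 2 * (2 * blinfun_apply (\<L> x) h))) (at x)"
      by (rule has_derivative_mult_right)
    moreover have "(blinfun_apply f has_derivative blinfun_apply f) (at x)"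
      by (rule bounded_linear_imp_has_derivative[OF blinfun.bounded_linear_right])
    ultimately have "((\<lambda>x. 1 / 2 * blinfun_apply (\<L> x) x - blinfun_apply f x) has_derivative
        (\<lambda>h. 1 / 2 * (2 * blinfun_apply (\<L> x) h) - blinfun_apply f h)) (at x)"
      by (rule has_derivative_diff)
    moreover have "blinfun_apply (\<L> x - f) =
        (\<lambda>h. 1 / 2 * (2 * blinfun_apply (\<L> x) h) - blinfun_apply f h)"
      by (simp add: fun_eq_iff blinfun.diff_left)
    moreover have "J = (\<lambda>x. 1 / 2 * blinfun_apply (\<L> x) x - blinfun_apply f x)"
      by (simp add: fun_eq_iff J_def)
    ultimately show "(J has_derivative blinfun_apply (\<L> x - f)) (at x)" by simp
  qed
  have "strongly_convex \<L> (\<lambda>x. \<L> x - f) 1"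
    by (simp add: strongly_convex_def L_norm_power2[OF P] L_inner_def
        linear_diff[OF preconditioner_linear[OF P]])
  from strongly_convex_minimizer_exists[OF P F this]
  obtain x where "\<And>y. J x \<le> J y" by blast
  then have "\<L> x - f = 0" by (rule frechet_deriv_global_min[OF F])
  then show "\<exists>x. f = \<L> x" by auto
qed

section \<open>One preconditioned gradient step\<close>

lemma L_inner_inv:
  fixes \<L> :: "'h::{real_normed_vector,complete_space} \<Rightarrow> ('h \<Rightarrow>\<^sub>L real)"
  assumes "preconditioner \<L>"
  shows "L_inner \<L> (inv \<L> f) y = blinfun_apply f y"
  by (simp add: L_inner_def surj_f_inv_f[OF preconditioner_surj[OF assms]])

lemma convex_L_ball:
  assumes P: "preconditioner \<L>"
  shows "convex {x. L_norm \<L> (x - c) \<le> R}"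
proof (rule convexI)
  fix x y and u v :: real
  assume h: "x \<in> {x. L_norm \<L> (x - c) \<le> R}" "y \<in> {x. L_norm \<L> (x - c) \<le> R}"
    and uv: "0 \<le> u" "0 \<le> v" "u + v = 1"
  have "u *\<^sub>R x + v *\<^sub>R y - c = u *\<^sub>R (x - c) + v *\<^sub>R (y - c)"
    using uv(3) by (simp add: algebra_simps flip: scaleR_add_left)
  then have "L_norm \<L> (u *\<^sub>R x + v *\<^sub>R y - c) \<le> u * L_norm \<L> (x - c) + v * L_norm \<L> (y - c)"
    using L_norm_triangle[OF P, of "u *\<^sub>R (x - c)" "v *\<^sub>R (y - c)"] uv by (simp add: L_norm_scaleR[OF P])
  also have "\<dots> \<le> R" using h uv by (intro convex_bound_le) auto
  finally show "u *\<^sub>R x + v *\<^sub>R y \<in> {x. L_norm \<L> (x - c) \<le> R}" by simp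
qed

lemma gradient_step_descent:
  fixes \<L> :: "'h::{real_normed_vector,complete_space} \<Rightarrow> ('h \<Rightarrow>\<^sub>L real)"
  assumes P: "preconditioner \<L>" and F: "frechet_deriv G G'"
    and L: "smoothness_constant \<L> G' B L" and B: "convex B" "y \<in> B"
    and z: "y - t *\<^sub>R inv \<L> (G' y) \<in> B" and t: "0 \<le> t" "t * L \<le> 1"
  shows "G (y - t *\<^sub>R inv \<L> (G' y)) \<le> G y - t / 2 * (L_norm \<L> (inv \<L> (G' y)))\<^sup>2"
proof -
  define g where "g = inv \<L> (G' y)"
  define c where "c = (L_norm \<L> g)\<^sup>2"
  have "blinfun_apply (G' y) g = c"
    using L_inner_inv[OF P, of "G' y" g] by (simp add: g_def c_def L_norm_power2[OF P])
  then have "G (y - t *\<^sub>R g) \<le> G y - t * c + L / 2 * (t\<^sup>2 * c)"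
    using smoothness_quadratic_bound[OF P F L B z] L_norm_scaleR[OF P, of "- t" g]
    by (simp add: g_def[symmetric] blinfun.bilinear_simps c_def power_mult_distrib)
  also have "L / 2 * (t\<^sup>2 * c) \<le> t / 2 * c"
    using mult_right_mono[OF t(2), of "t / 2 * c"] t(1)
    by (simp add: c_def power2_eq_square mult_ac)
  finally show ?thesis by (simp add: g_def c_def)
qed

text \<open>Smoothness is assumed only on a ball around the minimizer, so the descent estimate needs
  the new point to be in that ball beforehand. If the step of length \<open>s\<close> moved away from the
  minimizer, a shorter step of length \<open>T\<close> would return to exactly the initial distance, hence stay
  in the ball; the descent estimate for this shorter step contradicts strong convexity.\<close>

lemma gradient_step_nonexpansive:
  fixes \<L> :: "'h::{real_normed_vector,complete_space} \<Rightarrow> ('h \<Rightarrow>\<^sub>L real)"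
  assumes P: "preconditioner \<L>" and F: "frechet_deriv G G'" and S: "strongly_convex \<L> G' \<mu>"
    and min: "\<And>y. G p \<le> G y"
    and L: "smoothness_constant \<L> G' {x. L_norm \<L> (x - p) \<le> R} L"
    and y: "L_norm \<L> (y - p) \<le> R" and s: "0 < s" "s * L \<le> 1"
  shows "L_norm \<L> (y - s *\<^sub>R inv \<L> (G' y) - p) \<le> L_norm \<L> (y - p)"
proof (rule ccontr)
  define g where "g = inv \<L> (G' y)"
  define b where "b = L_inner \<L> g (y - p)"
  define c where "c = (L_norm \<L> g)\<^sup>2"
  have mu: "\<mu> > 0" using S by (simp add: strongly_convex_def)
  have Lpos: "L > 0" using L by (simp add: smoothness_constant_def)
  have dist: "(L_norm \<L> (y - t *\<^sub>R g - p))\<^sup>2 = (L_norm \<L> (y - p))\<^sup>2 - 2 * t * b + t\<^sup>2 * c" for t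
  proof -
    have "y - t *\<^sub>R g - p = (y - p) - t *\<^sub>R g" by simp
    then show ?thesis
      using L_inner_commute[OF P, of y g] L_inner_commute[OF P, of p g]
      by (simp only: L_norm_power2[OF P] b_def c_def)
         (simp add: L_inner_bilinear[OF P] power2_eq_square algebra_simps)
  qed
  have b: "G y - G p + \<mu> / 2 * (L_norm \<L> (y - p))\<^sup>2 \<le> b"
    using strongly_convex_quadratic_bound[OF P F S, of y p] L_norm_scaleR[OF P, of "-1" "y - p"]
    by (simp add: b_def g_def L_inner_inv[OF P] blinfun.diff_right)
  have b0: "0 \<le> b"
    using b min[of y] mu by (smt (verit) mult_nonneg_nonneg zero_le_power2 divide_pos_pos)
  assume "\<not> ?thesis"
  then have "(L_norm \<L> (y - p))\<^sup>2 < (L_norm \<L> (y - s *\<^sub>R g - p))\<^sup>2"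
    using L_norm_nonneg[OF P] by (intro power_strict_mono) (auto simp: g_def)
  then have "s * (2 * b) < s * (s * c)"
    unfolding dist by (simp add: power2_eq_square algebra_simps)
  then have bc: "2 * b < s * c" using s by simp
  then have c: "c > 0" using b0 s by (smt (verit) mult_nonneg_nonpos)
  \<comment> \<open>The second root (possibly a double root 0) of the quadratic equation in \<open>t\<close> stating that the
    squared distance at \<open>t\<close> equals its initial value.\<close>
  define T where "T = 2 * b / c"
  have T: "0 \<le> T" "T \<le> s" "T * c = 2 * b"
    using b0 bc c by (auto simp: T_def field_simps)
  have "(L_norm \<L> (y - T *\<^sub>R g - p))\<^sup>2 = (L_norm \<L> (y - p))\<^sup>2"
    unfolding dist using T(3) by (simp add: power2_eq_square)
  then have "L_norm \<L> (y - T *\<^sub>R g - p) \<le> R"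
    using y L_norm_nonneg[OF P] by (simp add: power2_eq_iff_nonneg)
  moreover have "T * L \<le> 1"
    using mult_right_mono[OF T(2), of L] Lpos s by linarith
  ultimately have "G (y - T *\<^sub>R g) \<le> G y - T / 2 * c"
    using gradient_step_descent[OF P F L convex_L_ball[OF P], of y T] y T(1)
    by (simp add: g_def c_def)
  then have "b \<le> G y - G p" using min[of "y - T *\<^sub>R g"] T(3) by simp
  then have "\<mu> / 2 * (L_norm \<L> (y - p))\<^sup>2 \<le> 0" using b by simp
  then have "L_norm \<L> (y - p) = 0" using mu by (simp add: mult_le_0_iff)
  then have "y = p" using L_norm_eq_0[OF P] by fastforce
  then have "G' y = 0" using frechet_deriv_global_min[OF F] min by blast
  then have "c = 0"
    using L_inner_inv[OF P, of "G' y" g] by (simp add: c_def L_norm_power2[OF P] g_def)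
  then show False using c by simp
qed

section \<open>Decay of the energy\<close>

text \<open>Here \<open>x\<close> is the current iterate, \<open>d\<close> the last increment and \<open>z\<close> the next iterate. Of strong
  convexity only plain convexity is used: the quadratic term is dropped.\<close>

lemma accelerated_step_energy:
  fixes \<L> :: "'h::{real_normed_vector,complete_space} \<Rightarrow> ('h \<Rightarrow>\<^sub>L real)"
  assumes P: "preconditioner \<L>" and F: "frechet_deriv G G'" and S: "strongly_convex \<L> G' \<mu>"
    and L: "smoothness_constant \<L> G' B L" and B: "convex B"
    and y: "y = x + \<beta> *\<^sub>R d" "y \<in> B"
    and z: "z = y - s *\<^sub>R inv \<L> (G' y)" "z \<in> B"
    and s: "0 < s" "s * L \<le> 1" and lam: "0 \<le> \<beta>" "\<beta> \<le> 1"
  shows "G z + (L_norm \<L> (z - x))\<^sup>2 / (2 * s) \<le> G x + (L_norm \<L> d)\<^sup>2 / (2 * s)"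
proof -
  define g where "g = inv \<L> (G' y)"
  define c where "c = (L_norm \<L> g)\<^sup>2"
  have mu: "\<mu> > 0" using S by (simp add: strongly_convex_def)
  have "G z \<le> G y - s / 2 * c"
    using gradient_step_descent[OF P F L B y(2), of s] z s by (simp add: c_def g_def)
  moreover have "G y - \<beta> * L_inner \<L> g d \<le> G x"
  proof -
    have "x - y = (- \<beta>) *\<^sub>R d" by (simp add: y(1))
    then have "blinfun_apply (G' y) (x - y) = - \<beta> * L_inner \<L> g d"
      by (simp only: g_def L_inner_inv[OF P] blinfun.scaleR_right) simp
    moreover have "0 \<le> \<mu> / 2 * (L_norm \<L> (x - y))\<^sup>2" using mu by simp
    ultimately show ?thesis using strongly_convex_quadratic_bound[OF P F S, of y x] by linarith
  qed
  moreover have "(L_norm \<L> (z - x))\<^sup>2 / (2 * s) =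
      \<beta>\<^sup>2 * (L_norm \<L> d)\<^sup>2 / (2 * s) - \<beta> * L_inner \<L> g d + s / 2 * c"
  proof -
    have "z - x = \<beta> *\<^sub>R d - s *\<^sub>R g" by (simp add: z(1) y(1) g_def)
    then have "(L_norm \<L> (z - x))\<^sup>2 =
        \<beta>\<^sup>2 * (L_norm \<L> d)\<^sup>2 - 2 * s * \<beta> * L_inner \<L> g d + s\<^sup>2 * c"
      using L_inner_commute[OF P, of d g]
      by (simp only: L_norm_power2[OF P] c_def)
         (simp add: L_inner_bilinear[OF P] power2_eq_square algebra_simps)
    then show ?thesis using s(1) by (simp add: power2_eq_square field_simps)
  qed
  moreover have "\<beta>\<^sup>2 * (L_norm \<L> d)\<^sup>2 / (2 * s) \<le> (L_norm \<L> d)\<^sup>2 / (2 * s)"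
    using s(1) lam by (intro divide_right_mono mult_left_le_one_le) (auto simp: power_le_one)
  ultimately show ?thesis by linarith
qed

section \<open>The invariant region of the iteration\<close>

theorem lemma5p2:
  fixes \<L> :: "'h::{real_inner,complete_space} \<Rightarrow> ('h \<Rightarrow>\<^sub>L real)"
    and G :: "'h \<Rightarrow> real" and G' :: "'h \<Rightarrow> ('h \<Rightarrow>\<^sub>L real)"
    and \<mu> \<eta> r s L_B R R1 R2 :: real and x0 xstar :: 'h and \<BB> :: "'h set"
  assumes "separable_space (euclidean :: 'h topology)"
    and "preconditioner \<L>"
    and "frechet_deriv G G'"
    and "strongly_convex \<L> G' \<mu>"
    and "locally_Lipschitz_smooth \<L> G'"
    and "xstar = minimizer G"
    and "r > 1"
    and "\<eta> = sqrt \<mu>"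
    and "R1 = sqrt (2 / \<mu> * (G x0 - G xstar))"
    and "R2 = sqrt (2 * r * (G x0 - G xstar))"
    and "R = R1 + 1 / \<eta> * R2"
    and "\<BB> = {x. L_norm \<L> (x - xstar) \<le> R}"
    and "smoothness_constant \<L> G' \<BB> L_B"
    and "s \<in> {0<..min (1 / L_B) (((r - 1) / (r + 1))\<^sup>2 * (1 / \<mu>))}"
  shows "\<forall>k. L_norm \<L> (pagd_x \<L> G' \<eta> s x0 k - xstar) \<le> R1 \<and>
             pagd_x \<L> G' \<eta> s x0 k \<in> \<BB> \<and>
             pagd_y \<L> G' \<eta> s x0 k \<in> \<BB> \<and>
             pagd_v \<L> G' \<eta> s x0 k \<in> \<BB>"
proof -
  note P = assms(2) and F = assms(3) and S = assms(4)
  have mu: "\<mu> > 0" using S by (simp add: strongly_convex_def)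
  have eta: "\<eta> > 0" using mu by (simp add: assms(8))
  have Lpos: "L_B > 0" using assms(13) by (simp add: smoothness_constant_def)
  have s: "0 < s" "s \<le> 1 / L_B" "s \<le> ((r - 1) / (r + 1))\<^sup>2 * (1 / \<mu>)" using assms(14) by auto
  have sL: "s * L_B \<le> 1" using s(2) Lpos by (simp add: field_simps)
  have min: "G xstar \<le> G y" for y using minimizer_le[OF P F S] by (simp add: assms(6))
  define D where "D = G x0 - G xstar"
  have D: "D \<ge> 0" using min[of x0] by (simp add: D_def)

  define \<theta> where "\<theta> = pagd_theta \<eta> s"
  define \<beta> where "\<beta> = pagd_lambda \<eta> s"
  have theta0: "\<theta> > 0" using eta s(1) by (simp add: \<theta>_def pagd_theta_def)
  have "\<theta>\<^sup>2 = \<mu> * s"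
    using mu s(1) by (simp add: \<theta>_def pagd_theta_def assms(8) power_mult_distrib)
  also have "\<dots> \<le> ((r - 1) / (r + 1))\<^sup>2" using mult_left_mono[OF s(3), of \<mu>] mu by simp
  finally have "\<theta> \<le> (r - 1) / (r + 1)"
    using assms(7) by (auto intro: power2_le_imp_le)
  also have "\<dots> < 1" using assms(7) by simp
  finally have theta1: "\<theta> < 1" .
  have lam: "0 \<le> \<beta>" "\<beta> \<le> 1"
    using theta0 theta1 by (auto simp: \<beta>_def pagd_lambda_def \<theta>_def[symmetric] field_simps)

  have R1: "R1 = sqrt (2 / \<mu> * D)" and R2: "R2 = sqrt (2 * r * D)"
    by (simp_all add: assms D_def)
  have R2_nonneg: "R2 \<ge> 0" using D assms(7) by (simp add: R2)
  have BB: "\<BB> = {x. L_norm \<L> (x - xstar) \<le> R}" by (fact assms(12))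
  have convB: "convex \<BB>" unfolding BB by (rule convex_L_ball[OF P])

  have x_bound: "L_norm \<L> (x - xstar) \<le> R1" if "G x \<le> G x0" for x
  proof -
    have "\<mu> / 2 * (L_norm \<L> (x - xstar))\<^sup>2 \<le> D"
      using strongly_convex_quadratic_bound[OF P F S, of xstar x] that
        frechet_deriv_global_min[OF F, of xstar] min by (simp add: D_def)
    then have "(L_norm \<L> (x - xstar))\<^sup>2 \<le> 2 / \<mu> * D" using mu by (simp add: field_simps)
    then show ?thesis unfolding R1 by (rule real_le_rsqrt)
  qed
  have d_bound: "(1 / \<theta>) * L_norm \<L> d \<le> 1 / \<eta> * R2"
    if "G x + (L_norm \<L> d)\<^sup>2 / (2 * s) \<le> G x0" for x d
  proof -
    have "(L_norm \<L> d)\<^sup>2 / (2 * s) \<le> D" using that min[of x] by (simp add: D_def)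
    then have "(L_norm \<L> d)\<^sup>2 \<le> s * (2 * D)" using s(1) by (simp add: field_simps)
    also have "\<dots> \<le> s * (2 * r * D)"
      using s(1) D assms(7) by (intro mult_left_mono) (simp_all add: mult_right_mono)
    finally have "L_norm \<L> d \<le> sqrt s * R2"
      unfolding R2 real_sqrt_mult[symmetric] by (rule real_le_rsqrt)
    then show ?thesis
      using eta s(1) by (simp add: \<theta>_def pagd_theta_def field_simps)
  qed
  \<comment> \<open>This covers the \<open>x\<close>-, \<open>y\<close>- and \<open>v\<close>-iterates, with \<open>a\<close> equal to 0, \<open>\<beta>\<close> and \<open>1 / \<theta>\<close>;
    note \<open>\<beta> \<le> 1 \<le> 1 / \<theta>\<close>.\<close>
  have in_ball: "x + a *\<^sub>R d \<in> \<BB>"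
    if "G x \<le> G x0" "G x' + (L_norm \<L> d)\<^sup>2 / (2 * s) \<le> G x0" "0 \<le> a" "a \<le> 1 / \<theta>" for x x' d a
  proof -
    have "x + a *\<^sub>R d - xstar = (x - xstar) + a *\<^sub>R d" by simp
    then have "L_norm \<L> (x + a *\<^sub>R d - xstar) \<le> L_norm \<L> (x - xstar) + a * L_norm \<L> d"
      using L_norm_triangle[OF P, of "x - xstar" "a *\<^sub>R d"] that(3)
      by (simp only: L_norm_scaleR[OF P] abs_of_nonneg)
    also have "a * L_norm \<L> d \<le> (1 / \<theta>) * L_norm \<L> d"
      using that(4) L_norm_nonneg[OF P] by (rule mult_right_mono)
    also have "\<dots> \<le> 1 / \<eta> * R2" by (rule d_bound[OF that(2)])
    finally show ?thesis using x_bound[OF that(1)] by (simp add: BB assms(11))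
  qed
  have "1 \<le> 1 / \<theta>" using theta0 theta1 by simp
  then have lam_theta: "\<beta> \<le> 1 / \<theta>" using lam(2) by linarith

  define xk where "xk = pagd_x \<L> G' \<eta> s x0"
  define yk where "yk = pagd_y \<L> G' \<eta> s x0"
  define dk where "dk k = xk k - fst (pagd_state \<L> G' \<eta> s x0 k)" for k
  have yk: "yk k = xk k + \<beta> *\<^sub>R dk k" for k
    by (simp add: yk_def xk_def dk_def \<beta>_def pagd_y_def pagd_x_def pagd_extrapolate_def split_beta)
  have xk0: "xk 0 = x0" "dk 0 = 0" by (simp_all add: xk_def dk_def pagd_x_def)
  have xk_Suc: "xk (Suc k) = yk k - s *\<^sub>R inv \<L> (G' (yk k))" "dk (Suc k) = xk (Suc k) - xk k" for k
    by (simp_all add: xk_def yk_def dk_def pagd_x_def pagd_y_def Let_def)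

  have energy: "G (xk k) + (L_norm \<L> (dk k))\<^sup>2 / (2 * s) \<le> G x0" for k
  proof (induction k)
    case 0
    show ?case using L_norm_scaleR[OF P, of 0 0] by (simp add: xk0)
  next
    case (Suc k)
    have "G (xk k) \<le> G x0" using Suc s(1) by (smt (verit) divide_nonneg_pos zero_le_power2)
    then have y: "yk k \<in> \<BB>" unfolding yk using Suc lam(1) lam_theta by (rule in_ball)
    have "L_norm \<L> (xk (Suc k) - xstar) \<le> L_norm \<L> (yk k - xstar)"
      unfolding xk_Suc(1)
      by (rule gradient_step_nonexpansive[OF P F S min assms(13)[unfolded BB] _ s(1) sL])
         (use y in \<open>simp add: BB\<close>)
    then have "xk (Suc k) \<in> \<BB>" using y by (simp add: BB)
    from accelerated_step_energy[OF P F S assms(13) convB yk y xk_Suc(1) this s(1) sL lam] Suc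
    show ?case by (simp add: xk_Suc(2))
  qed
  have G_le: "G (xk k) \<le> G x0" for k
    using energy[of k] s(1) by (smt (verit) divide_nonneg_pos zero_le_power2)
  have x_in: "xk k \<in> \<BB>" for k
    using in_ball[OF G_le energy, of 0 k k] theta0 by simp
  have y_in: "yk k \<in> \<BB>" for k
    unfolding yk using G_le energy lam(1) lam_theta by (rule in_ball)
  have v_in: "pagd_v \<L> G' \<eta> s x0 k \<in> \<BB>" for k
  proof (cases k)
    case 0
    then show ?thesis using x_in[of 0] by (simp add: xk0)
  next
    case (Suc n)
    have "pagd_v \<L> G' \<eta> s x0 k = xk n + (1 / \<theta>) *\<^sub>R dk (Suc n)"
      by (simp add: Suc \<theta>_def xk_Suc(2)) (simp add: xk_def)
    also have "\<dots> \<in> \<BB>"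
      using in_ball[OF G_le energy, of "1 / \<theta>" n "Suc n"] theta0 by simp
    finally show ?thesis .
  qed
  show ?thesis using x_bound[OF G_le] x_in y_in v_in by (simp add: xk_def yk_def)
qed

end
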